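(* Let $U,V\subset\mathbb R^3$ be domains, $(s,t)\subset\mathbb R$ an open interval, $\underline a=\sum_{i=1}^3a_ie_i\in C^1(U,V)$ a diffeomorphism with real-valued components, and $a:(s,t)\times U\to(s,t)\times V$, $a(x)=x_0+\underline a(\underline x)$. Suppose $\mathbb B^4(0,1)\subset(s,t)\times V$. If $f\in C^1((s,t)\times U,\mathbb H)$ satisfies $\mathcal H_a(f)=0$ on $(s,t)\times U$, then there exists a sequence of quaternions $(c_k)_{k\ge0}$ such that $$f(x)=\sum_{k=0}^\infty(a(x))^kc_k,\qquad\forall x\in a^{-1}(\mathbb B^4(0,1)).$$ Similarly, if $f\in C^1((s,t)\times U,\mathbb H)$ satisfies $\mathcal H_{a,r}(f)=0$ on $(s,t)\times U$, then there exists a sequence of quaternions $(c_k)_{k\ge0}$ such that $$f(x)=\sum_{k=0}^\infty c_k(a(x))^k,\qquad\forall x\in a^{-1}(\mathbb B^4(0,1)).$$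
   Context: $\mathbb H$ is the skew-field of quaternions with imaginary units $e_1,e_2,e_3$; $x=x_0+\underline x$ with $\underline x=\sum_{k=1}^3x_ke_k$, and $\mathbb R\times\mathbb R^3$ is identified with $\mathbb H$. $\mathbb B^4(0,1)=\{q\in\mathbb H:\|q\|<1\}$. "Diffeomorphism" means a $C^1$ bijection with $C^1$ inverse; $a^{-1}(y)=y_0+\sum_{j=1}^3(a^{-1})_j(\underline y)e_j$, with $(a^{-1})_j$ the $j$-th real component of $(\underline a)^{-1}$. With $u_i:=\sum_{j=1}^3a_j\big(\frac{\partial(a^{-1})_i}{\partial y_j}\circ a\big)$, $i=1,2,3$, $$\mathcal H_a(f)=\underline a\frac{\partial f}{\partial x_0}-\sum_{i=1}^3u_i\frac{\partial f}{\partial x_i},\qquad \mathcal H_{a,r}(f)=\frac{\partial f}{\partial x_0}\underline a-\sum_{i=1}^3u_i\frac{\partial f}{\partial x_i},$$ where $\underline a$, $a_j$ are evaluated at $\underline x$. *)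

theory Defs
  imports "HOL-Analysis.Analysis"
begin

section \<open>The quaternions\<close>

text \<open>
  A quaternion is a pair of a real part \<open>x\<^sub>0\<close> and a vector part in \<open>\<real>\<^sup>3\<close>; this is the
  identification of \<open>\<real> \<times> \<real>\<^sup>3\<close> with the skew-field of quaternions.  The Hamilton product is
  written with the inner product and the cross product of the vector parts; the lemma
  \<open>qunit_mult\<close> below recovers the multiplication table of the imaginary units.
\<close>

datatype quat = Quat (qRe: real) (qVec: "real^3")

lemma quat_eq_iff: "x = y \<longleftrightarrow> qRe x = qRe y \<and> qVec x = qVec y"
  by (cases x; cases y) auto

instantiation quat :: real_vector
begin

definition "0 = Quat 0 0"
definition "x + y = Quat (qRe x + qRe y) (qVec x + qVec y)"
definition "x - y = Quat (qRe x - qRe y) (qVec x - qVec y)"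
definition "- x = Quat (- qRe x) (- qVec x)"
definition "r *\<^sub>R x = Quat (r * qRe x) (r *\<^sub>R qVec x)"

instance
  by standard
    (simp_all add: zero_quat_def plus_quat_def minus_quat_def uminus_quat_def
      scaleR_quat_def quat_eq_iff algebra_simps)

end

instantiation quat :: real_inner
begin

definition "inner x y = qRe x * qRe y + qVec x \<bullet> qVec y"
definition "norm (x::quat) = sqrt (x \<bullet> x)"
definition "dist (x::quat) y = norm (x - y)"
definition "sgn (x::quat) = x /\<^sub>R norm x"
definition [code del]:
  "(uniformity :: (quat \<times> quat) filter) = (INF e\<in>{0 <..}. principal {(x, y). dist x y < e})"
definition [code del]:
  "open (S :: quat set) \<longleftrightarrow> (\<forall>x\<in>S. \<forall>\<^sub>F (x', y) in uniformity. x' = x \<longrightarrow> y \<in> S)"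

instance
proof
  fix x y z :: quat and r :: real
  show "inner x y = inner y x"
    by (simp add: inner_quat_def inner_commute mult.commute)
  show "inner (x + y) z = inner x z + inner y z"
    by (simp add: inner_quat_def plus_quat_def algebra_simps)
  show "inner (r *\<^sub>R x) y = r * inner x y"
    by (simp add: inner_quat_def scaleR_quat_def algebra_simps)
  show "0 \<le> inner x x"
    by (simp add: inner_quat_def)
  show "inner x x = 0 \<longleftrightarrow> x = 0"
    by (simp add: inner_quat_def quat_eq_iff zero_quat_def add_nonneg_eq_0_iff)
qed (simp_all add: dist_quat_def sgn_quat_def norm_quat_def uniformity_quat_def open_quat_def)

end

instantiation quat :: real_normed_div_algebra
begin

definition "1 = Quat 1 0"
definition "x * y =
  Quat (qRe x * qRe y - qVec x \<bullet> qVec y)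
       (qRe x *\<^sub>R qVec y + qRe y *\<^sub>R qVec x + cross3 (qVec x) (qVec y))"
definition "inverse x = Quat (qRe x / (norm x)\<^sup>2) (- qVec x /\<^sub>R (norm x)\<^sup>2)"
definition "x div (y::quat) = x * inverse y"

instance
proof
  fix x y z :: quat and r :: real
  note defs = zero_quat_def plus_quat_def scaleR_quat_def one_quat_def times_quat_def
    quat_eq_iff cross3_def inner_vec_def sum_3 vec_eq_iff forall_3
  show "x * y * z = x * (y * z)"
    by (simp add: defs algebra_simps)
  show "(x + y) * z = x * z + y * z"
    by (simp add: defs algebra_simps)
  show "x * (y + z) = x * y + x * z"
    by (simp add: defs algebra_simps)
  show "1 * x = x" "x * 1 = x" "(0::quat) \<noteq> 1"
    by (simp_all add: defs)
  show "r *\<^sub>R x * y = r *\<^sub>R (x * y)" "x * r *\<^sub>R y = r *\<^sub>R (x * y)"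
    by (simp_all add: defs algebra_simps)
  show "norm (x * y) = norm x * norm y"
    unfolding norm_quat_def real_sqrt_mult [symmetric]
    by (simp add: defs inner_quat_def algebra_simps)
  show "inverse (0::quat) = 0"
    by (simp add: inverse_quat_def zero_quat_def)
  show "x div y = x * inverse y"
    by (fact divide_quat_def)
  assume "x \<noteq> 0"
  then have nz: "x \<bullet> x \<noteq> 0" by simp
  have n2: "(norm x)\<^sup>2 = x \<bullet> x"
    by (simp add: power2_norm_eq_inner)
  have xx: "x \<bullet> x = qRe x * qRe x + qVec x \<bullet> qVec x"
    by (simp add: inner_quat_def)
  have c: "cross3 v (r *\<^sub>R - v) = 0" "cross3 (r *\<^sub>R - v) v = 0" for r and v :: "real^3"
    by (simp_all add: defs)
  have one: "qRe x / (x \<bullet> x) * qRe x + inverse (x \<bullet> x) * (qVec x \<bullet> qVec x) = 1"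
  proof -
    have "p / d * p + inverse d * w = (p * p + w) / d" for p d w :: real
      by (simp add: divide_inverse algebra_simps)
    then show ?thesis using nz xx by simp
  qed
  show "inverse x * x = 1" "x * inverse x = 1"
    using one unfolding inverse_quat_def n2 times_quat_def one_quat_def quat.sel c
    by (simp_all add: quat_eq_iff divide_inverse mult.commute)
qed

end

instantiation quat :: euclidean_space
begin

definition "Basis = insert (Quat 1 0) (Quat 0 ` Basis)"

instance
proof
  show "(Basis :: quat set) \<noteq> {}" "finite (Basis :: quat set)"
    by (simp_all add: Basis_quat_def)
  fix u v :: quat
  show "u \<in> Basis \<Longrightarrow> v \<in> Basis \<Longrightarrow> u \<bullet> v = (if u = v then 1 else 0)"
    by (auto simp: Basis_quat_def inner_quat_def inner_Basis split: if_splits)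
  show "(\<forall>v\<in>Basis. u \<bullet> v = 0) \<longleftrightarrow> u = 0"
    by (auto simp: Basis_quat_def inner_quat_def quat_eq_iff zero_quat_def
        euclidean_all_zero_iff)
qed

end

definition qunit :: "3 \<Rightarrow> quat" where
  "qunit i = Quat 0 (axis i 1)"

lemma qunit_mult:
  "qunit 1 * qunit 1 = - 1" "qunit 2 * qunit 2 = - 1" "qunit 3 * qunit 3 = - 1"
  "qunit 1 * qunit 2 = qunit 3" "qunit 2 * qunit 1 = - qunit 3"
  "qunit 2 * qunit 3 = qunit 1" "qunit 3 * qunit 2 = - qunit 1"
  "qunit 3 * qunit 1 = qunit 2" "qunit 1 * qunit 3 = - qunit 2"
  by (auto simp: qunit_def times_quat_def one_quat_def uminus_quat_def quat_eq_iff
      cross3_def inner_vec_def sum_3 vec_eq_iff forall_3 axis_def)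

lemma quat_expansion: "x = of_real (qRe x) + (\<Sum>k\<in>UNIV. (qVec x $ k) *\<^sub>R qunit k)"
  by (simp add: of_real_def sum_3 qunit_def one_quat_def scaleR_quat_def plus_quat_def
      quat_eq_iff vec_eq_iff forall_3 axis_def)

section \<open>Differentiability\<close>

text \<open>Intended for open \<open>S\<close>.\<close>

definition C1_on :: "'a::real_normed_vector set \<Rightarrow> ('a \<Rightarrow> 'b::real_normed_vector) \<Rightarrow> bool" where
  "C1_on S f \<longleftrightarrow>
    (\<exists>f' :: 'a \<Rightarrow> 'a \<Rightarrow>\<^sub>L 'b.
      (\<forall>x\<in>S. (f has_derivative blinfun_apply (f' x)) (at x)) \<and> continuous_on S f')"

definition C1_diffeomorphism ::
    "'a::real_normed_vector set \<Rightarrow> 'b::real_normed_vector set \<Rightarrow> ('a \<Rightarrow> 'b) \<Rightarrow> bool" where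
  "C1_diffeomorphism U V a \<longleftrightarrow>
    bij_betw a U V \<and> C1_on U a \<and> C1_on V (inv_into U a)"

definition partial_deriv ::
    "'a::real_normed_vector \<Rightarrow> ('a \<Rightarrow> 'b::real_normed_vector) \<Rightarrow> 'a \<Rightarrow> 'b" where
  "partial_deriv e f x = vector_derivative (\<lambda>h::real. f (x + h *\<^sub>R e)) (at 0)"

section \<open>The operators\<close>

text \<open>\<open>(s,t) \<times> U\<close> as a set of quaternions; \<open>s\<close> and \<open>t\<close> may be infinite.\<close>

definition cylinder :: "ereal \<Rightarrow> ereal \<Rightarrow> (real^3) set \<Rightarrow> quat set" where
  "cylinder s t U = {x. qRe x \<in> einterval s t \<and> qVec x \<in> U}"

text \<open>
  The map \<open>x\<^sub>0 + x \<mapsto> x\<^sub>0 + b(x)\<close>; it is applied both to \<open>a\<close> and to the inverse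
  \<open>inv_into U a\<close>.
\<close>

definition lift_map :: "(real^3 \<Rightarrow> real^3) \<Rightarrow> quat \<Rightarrow> quat" where
  "lift_map b x = Quat (qRe x) (b (qVec x))"

definition ucoeff :: "(real^3) set \<Rightarrow> (real^3 \<Rightarrow> real^3) \<Rightarrow> 3 \<Rightarrow> real^3 \<Rightarrow> real" where
  "ucoeff U a i v =
    (\<Sum>j\<in>UNIV. a v $ j * partial_deriv (axis j 1) (\<lambda>y. inv_into U a y $ i) (a v))"

definition H_left :: "(real^3) set \<Rightarrow> (real^3 \<Rightarrow> real^3) \<Rightarrow> (quat \<Rightarrow> quat) \<Rightarrow> quat \<Rightarrow> quat" where
  "H_left U a f x =
    Quat 0 (a (qVec x)) * partial_deriv 1 f x
    - (\<Sum>i\<in>UNIV. ucoeff U a i (qVec x) *\<^sub>R partial_deriv (qunit i) f x)"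

definition H_right :: "(real^3) set \<Rightarrow> (real^3 \<Rightarrow> real^3) \<Rightarrow> (quat \<Rightarrow> quat) \<Rightarrow> quat \<Rightarrow> quat" where
  "H_right U a f x =
    partial_deriv 1 f x * Quat 0 (a (qVec x))
    - (\<Sum>i\<in>UNIV. ucoeff U a i (qVec x) *\<^sub>R partial_deriv (qunit i) f x)"

end

theory Submission
  imports Defs "HOL-Complex_Analysis.Complex_Analysis"
begin

text \<open>
  Put \<open>g = f \<circ> a\<^sup>-\<^sup>1\<close>.  By the chain rule the coefficients \<open>u\<^sub>i\<close> are the components of the derivative
  of the inverse of \<open>a\<close> in the direction of the vector part \<open>v\<close> of \<open>y\<close>, so \<open>\<H>\<^sub>a(f) = 0\<close> says
  \<open>v \<partial>\<^sub>0 g = \<partial>\<^sub>v g\<close>.  On each plane spanned by \<open>1\<close> and a unit vector \<open>n\<close> this is, off the real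
  axis, the Cauchy-Riemann equation for the complex structure given by multiplication with \<open>n\<close>;
  continuity carries holomorphy across the axis.  Hence \<open>g\<close> is a power series on the unit disc of
  each plane, and the identity theorem makes the coefficients the same for all planes, because
  the planes share the real axis.  Left and right multiplication are treated at once as actions
  of the quaternions on themselves.
\<close>

section \<open>Slice planes\<close>

text \<open>For a unit vector \<open>n\<close>, this identifies the complex plane isometrically with
  the plane spanned by \<open>1\<close> and \<open>n\<close>, the imaginary unit going to
  \<open>n\<close>. All these planes share the real axis.\<close>

definition slice_embed :: "real^3 \<Rightarrow> complex \<Rightarrow> quat" where
  "slice_embed n z = Quat (Re z) (Im z *\<^sub>R n)"

lemma bounded_linear_slice_embed: "bounded_linear (slice_embed n)"
  by (intro linear_conv_bounded_linear [THEN iffD1] linearI)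
    (simp_all add: slice_embed_def plus_quat_def scaleR_quat_def algebra_simps)

lemma slice_embed_of_real: "slice_embed n (of_real x) = of_real x"
  by (simp add: slice_embed_def of_real_def scaleR_quat_def one_quat_def)

lemma norm_slice_embed:
  assumes "norm n = 1"
  shows "norm (slice_embed n z) = norm z"
proof -
  have "n \<bullet> n = 1" using assms by (simp add: norm_eq_1)
  then show ?thesis
    by (simp add: slice_embed_def norm_quat_def inner_quat_def cmod_def power2_eq_square)
qed

lemma slice_embed_eq: "slice_embed n z = Re z *\<^sub>R 1 + Im z *\<^sub>R Quat 0 n"
  by (simp add: slice_embed_def plus_quat_def scaleR_quat_def one_quat_def)

lemma unit_vector_squared:
  assumes "norm n = 1"
  shows "Quat 0 n * Quat 0 n = - 1"
  using assms
  by (simp add: times_quat_def uminus_quat_def one_quat_def norm_eq_1 cross_refl)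

text \<open>The planes cover the quaternions: a nonzero vector part is normalised to give
  \<open>n\<close>. A real quaternion lies in every plane, so any unit vector serves.\<close>

lemma slice_embed_exists:
  obtains n z where "norm n = 1" "slice_embed n z = y"
proof (cases "qVec y = 0")
  case True
  then have "slice_embed (axis 1 1) (of_real (qRe y)) = y"
    by (simp add: slice_embed_def quat_eq_iff)
  then show ?thesis using that [of "axis 1 1"] by (simp add: norm_axis_1)
next
  case False
  then have "slice_embed (qVec y /\<^sub>R norm (qVec y)) (Complex (qRe y) (norm (qVec y))) = y"
    by (simp add: slice_embed_def quat_eq_iff)
  then show ?thesis using that [of "qVec y /\<^sub>R norm (qVec y)"] False by simp
qed

section \<open>Solutions of the slice Cauchy-Riemann equation\<close>

text \<open>
  Multiplicativity is only required of commuting quaternions, so that right multiplication is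
  an instance as well.
\<close>

locale quat_action = bounded_bilinear act
  for act :: "quat \<Rightarrow> 'b::euclidean_space \<Rightarrow> 'b" +
  assumes act_one: "act 1 q = q"
    and act_mult: "p * r = r * p \<Longrightarrow> act (p * r) q = act p (act r q)"
begin

text \<open>The real coordinate along \<open>w\<close> is completed to a complex one. As
  \<open>act (Quat 0 n)\<close> squares to minus the identity for a unit vector \<open>n\<close>,
  this imaginary part, with its sign, turns the action of \<open>n\<close> into multiplication by
  the imaginary unit. The real part alone still determines \<open>q\<close> when \<open>w\<close>
  varies.\<close>

definition cpart :: "real^3 \<Rightarrow> 'b \<Rightarrow> 'b \<Rightarrow> complex" where
  "cpart n w q = Complex (q \<bullet> w) (- (act (Quat 0 n) q \<bullet> w))"

lemma Re_cpart: "Re (cpart n w q) = q \<bullet> w"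
  by (simp add: cpart_def)

lemma bounded_linear_cpart: "bounded_linear (cpart n w)"
  by (intro linear_conv_bounded_linear [THEN iffD1] linearI)
    (simp_all add: cpart_def add_right scaleR_right inner_add_left complex_eq_iff)

lemma act_unit_act_unit:
  assumes "norm n = 1"
  shows "act (Quat 0 n) (act (Quat 0 n) q) = - q"
  using act_mult [of "Quat 0 n" "Quat 0 n" q]
  by (simp add: unit_vector_squared [OF assms] minus_left act_one)

lemma cpart_act_unit:
  assumes "norm n = 1"
  shows "cpart n w (act (Quat 0 n) q) = \<i> * cpart n w q"
  by (simp add: cpart_def act_unit_act_unit [OF assms] complex_eq_iff)

lemma cpart_act:
  assumes "norm n = 1"
  shows "cpart n w (act (slice_embed n z) q) = z * cpart n w q"
proof -
  interpret cp: bounded_linear "cpart n w" by (rule bounded_linear_cpart)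
  show ?thesis
    by (simp add: slice_embed_eq add_left scaleR_left act_one cp.add cp.scaleR
        cpart_act_unit [OF assms] complex_eq_iff)
qed

lemma act_power_Suc: "act (p ^ Suc k) q = act p (act (p ^ k) q)"
  using act_mult [of p "p ^ k" q] by (simp add: power_commutes)

lemma cpart_act_power:
  assumes "norm n = 1"
  shows "cpart n w (act (slice_embed n z ^ k) q) = z ^ k * cpart n w q"
proof (induction k)
  case (Suc k)
  then show ?case by (simp add: act_power_Suc cpart_act [OF assms] del: power_Suc)
      (simp add: mult.assoc)
qed (simp add: act_one)

lemma holomorphic_slice:
  fixes g :: "quat \<Rightarrow> 'b" and g' :: "quat \<Rightarrow> quat \<Rightarrow> 'b"
  assumes n: "norm n = 1"
    and deriv: "\<And>y. y \<in> ball 0 1 \<Longrightarrow> (g has_derivative g' y) (at y)"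
    and CR: "\<And>y. y \<in> ball 0 1 \<Longrightarrow> act (Quat 0 (qVec y)) (g' y 1) = g' y (Quat 0 (qVec y))"
  shows "(\<lambda>z. cpart n w (g (slice_embed n z))) holomorphic_on ball 0 1"
proof -
  let ?h = "\<lambda>z. cpart n w (g (slice_embed n z))"
  let ?D = "\<lambda>z e. cpart n w (g' (slice_embed n z) (slice_embed n e))"
  have inb: "slice_embed n z \<in> ball 0 1" if "z \<in> ball 0 1" for z
    using that by (simp add: norm_slice_embed [OF n])
  have h_deriv: "(?h has_derivative ?D z) (at z)" if "z \<in> ball 0 1" for z
  proof (rule bounded_linear.has_derivative [OF bounded_linear_cpart])
    show "((\<lambda>z. g (slice_embed n z)) has_derivative
        (\<lambda>e. g' (slice_embed n z) (slice_embed n e))) (at z)"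
      by (rule has_derivative_compose [OF bounded_linear_imp_has_derivative
            [OF bounded_linear_slice_embed] deriv [OF inb [OF that]]])
  qed
  have field: "?h field_differentiable at z" if z: "z \<in> ball 0 1" and "Im z \<noteq> 0" for z
  proof -
    let ?g' = "g' (slice_embed n z)"
    interpret g': bounded_linear ?g'
      using deriv [OF inb [OF z]] by (rule has_derivative_bounded_linear)
    interpret cp: bounded_linear "cpart n w" by (rule bounded_linear_cpart)
    have "Quat 0 (qVec (slice_embed n z)) = Im z *\<^sub>R Quat 0 n"
      by (simp add: slice_embed_def scaleR_quat_def)
    \<comment> \<open>The vector part on the slice is \<open>Im z\<close> times \<open>n\<close>, so
      the equation carries a factor \<open>Im z\<close>. It can be cancelled off the real axis and
      says nothing on it.\<close>
    with CR [OF inb [OF z]] have "Im z *\<^sub>R act (Quat 0 n) (?g' 1) = Im z *\<^sub>R ?g' (Quat 0 n)"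
      by (simp add: scaleR_left g'.scaleR)
    with \<open>Im z \<noteq> 0\<close> have eq: "?g' (Quat 0 n) = act (Quat 0 n) (?g' 1)" by simp
    \<comment> \<open>The real-linear derivative is determined by its values at \<open>1\<close> and
      \<open>n\<close>; the second is now the imaginary unit times the first, so the derivative is
      complex-linear.\<close>
    have "?D z e = cpart n w (?g' 1) * e" for e
      by (simp add: slice_embed_eq [of n e] g'.add g'.scaleR eq cp.add cp.scaleR
          cpart_act_unit [OF n] complex_eq_iff)
    then have "?D z = (*) (cpart n w (?g' 1))" by (rule ext)
    with h_deriv [OF z] show ?thesis
      by (auto simp: field_differentiable_def has_field_derivative_def)
  qed
  have half: "?h holomorphic_on (ball 0 1 \<inter> S)" if "\<And>z. z \<in> S \<Longrightarrow> Im z \<noteq> 0" for S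
    using that field by (auto simp: holomorphic_on_def intro: field_differentiable_at_within)
  show ?thesis
  \<comment> \<open>Since \<open>\<i> \<bullet> z\<close> is \<open>Im z\<close>, the line pasted
    across is the real axis.\<close>
  proof (rule holomorphic_on_paste_across_line [of "ball 0 1" \<i> _ 0])
    show "continuous_on (ball 0 1) ?h"
      by (rule has_derivative_continuous_on [OF has_derivative_at_withinI [OF h_deriv]])
    show "?h holomorphic_on (ball 0 1 \<inter> {z. \<i> \<bullet> z < 0})"
      "?h holomorphic_on (ball 0 1 \<inter> {z. 0 < \<i> \<bullet> z})"
      by (intro half; simp add: inner_complex_def)+
  qed simp_all
qed

section \<open>Power series on the real axis and on the whole ball\<close>

lemma real_axis_power_series:
  fixes g :: "quat \<Rightarrow> 'b"
  assumes hol: "\<And>n w. norm n = 1 \<Longrightarrow>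
      (\<lambda>z. cpart n w (g (slice_embed n z))) holomorphic_on ball 0 1"
  obtains c where "\<And>x::real. \<bar>x\<bar> < 1 \<Longrightarrow> (\<lambda>k. x ^ k *\<^sub>R c k) sums g (of_real x)"
proof -
  \<comment> \<open>The real axis lies in every slice, so one arbitrarily chosen slice yields the
    coefficients.\<close>
  define n :: "real^3" where "n = axis 1 1"
  have n: "norm n = 1" by (simp add: n_def norm_axis_1)
  define h where "h w z = cpart n w (g (slice_embed n z))" for w z
  \<comment> \<open>At real points the powers are real, so taking real parts of the Taylor series of
    \<open>h b\<close> gives a real power series for the coordinate along \<open>b\<close>. Its
    coefficients are the coordinates of \<open>c k\<close>.\<close>
  define c where "c k = (\<Sum>b\<in>Basis. Re ((deriv ^^ k) (h b) 0 / fact k) *\<^sub>R b)" for k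
  have "(\<lambda>k. x ^ k *\<^sub>R c k) sums g (of_real x)" if "\<bar>x\<bar> < 1" for x :: real
  proof -
    have "(\<lambda>k. Re ((deriv ^^ k) (h b) 0 / fact k) * x ^ k) sums (g (of_real x) \<bullet> b)" for b
    proof -
      have "(\<lambda>k. (deriv ^^ k) (h b) 0 / fact k * (of_real x - 0) ^ k) sums h b (of_real x)"
        using that hol [OF n] by (intro holomorphic_power_series) (auto simp: h_def [abs_def])
      then have "(\<lambda>k. Re ((deriv ^^ k) (h b) 0 / fact k * (of_real x - 0) ^ k))
          sums Re (h b (of_real x))"
        by (rule sums_Re)
      moreover have "Re (d * (of_real x - 0) ^ k) = Re d * x ^ k" for d :: complex and k
        by (simp flip: of_real_power)
      moreover have "Re (h b (of_real x)) = g (of_real x) \<bullet> b"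
        by (simp add: h_def Re_cpart slice_embed_of_real)
      ultimately show ?thesis
        by (simp only:)
    qed
    then have "(\<lambda>k. (Re ((deriv ^^ k) (h b) 0 / fact k) * x ^ k) *\<^sub>R b)
        sums ((g (of_real x) \<bullet> b) *\<^sub>R b)" for b
      by (rule bounded_linear.sums [OF bounded_linear_scaleR_left])
    then have "(\<lambda>k. \<Sum>b\<in>Basis. (Re ((deriv ^^ k) (h b) 0 / fact k) * x ^ k) *\<^sub>R b)
        sums (\<Sum>b\<in>Basis. (g (of_real x) \<bullet> b) *\<^sub>R b)"
      by (rule sums_sum)
    then show ?thesis
      by (simp add: c_def scaleR_sum_right euclidean_representation mult.commute)
  qed
  then show ?thesis by (rule that)
qed

text \<open>The coefficients come from the real axis. On any slice, \<open>cpart\<close> turns the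
  candidate series into a complex power series that agrees with a holomorphic function on
  \<open>(-1,1)\<close>, hence on the disc.\<close>

theorem slice_power_series:
  fixes g :: "quat \<Rightarrow> 'b" and g' :: "quat \<Rightarrow> quat \<Rightarrow> 'b"
  assumes deriv: "\<And>y. y \<in> ball 0 1 \<Longrightarrow> (g has_derivative g' y) (at y)"
    and CR: "\<And>y. y \<in> ball 0 1 \<Longrightarrow> act (Quat 0 (qVec y)) (g' y 1) = g' y (Quat 0 (qVec y))"
  obtains c where "\<And>y. y \<in> ball 0 1 \<Longrightarrow> (\<lambda>k. act (y ^ k) (c k)) sums g y"
proof -
  have hol: "(\<lambda>z. cpart n w (g (slice_embed n z))) holomorphic_on ball 0 1"
    if "norm n = 1" for n w
    using that deriv CR by (rule holomorphic_slice)
  obtain c where c: "(\<lambda>k. x ^ k *\<^sub>R c k) sums g (of_real x)" if "\<bar>x\<bar> < 1" for x :: real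
    using real_axis_power_series hol by blast
  have "(\<lambda>k. act (y ^ k) (c k)) sums g y" if y: "y \<in> ball 0 1" for y
  proof -
    obtain n z where n: "norm n = 1" and yz: "slice_embed n z = y"
      by (rule slice_embed_exists)
    with y have z: "z \<in> ball 0 1" by (auto simp: norm_slice_embed [OF n])
    have "(\<lambda>k. act (y ^ k) (c k) \<bullet> w) sums (g y \<bullet> w)" for w
    proof -
      interpret cp: bounded_linear "cpart n w" by (rule bounded_linear_cpart)
      define h where "h z = cpart n w (g (slice_embed n z))" for z
      have real: "(\<lambda>k. cpart n w (c k) * of_real x ^ k) sums h (of_real x)"
        if "\<bar>x\<bar> < 1" for x :: real
        using cp.sums [OF c [OF that]]
        by (simp add: cp.scaleR h_def slice_embed_of_real scaleR_conv_of_real mult.commute)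
      define H where "H z = (\<Sum>k. cpart n w (c k) * z ^ k)" for z
      have H: "(\<lambda>k. cpart n w (c k) * (u - 0) ^ k) sums H u" if u: "u \<in> ball 0 1" for u
      proof -
        \<comment> \<open>Convergence at a real point farther from 0 than \<open>u\<close> gives
          convergence at \<open>u\<close>.\<close>
        obtain x where x: "norm u < x" "x < 1" using u dense [of "norm u" 1] by auto
        moreover from x have "0 \<le> x" using norm_ge_zero [of u] by linarith
        ultimately have "summable (\<lambda>k. cpart n w (c k) * u ^ k)"
          using powser_inside [OF sums_summable [OF real [of x]], of u] by simp
        then show ?thesis by (simp add: H_def summable_sums)
      qed
      have "h z - H z = 0"
      proof (rule analytic_continuation [of "\<lambda>z. h z - H z" "ball 0 1" "of_real ` {-1<..<1}" 0 z])
        show "(\<lambda>z. h z - H z) holomorphic_on ball 0 1"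
          using hol [OF n] power_series_holomorphic [OF H]
          by (intro holomorphic_on_diff) (auto simp: h_def [abs_def])
        show "h u - H u = 0" if u: "u \<in> of_real ` {-1<..<1}" for u
        proof -
          obtain x :: real where x: "u = of_real x" "\<bar>x\<bar> < 1" using u by auto
          with H [of u] have "(\<lambda>k. cpart n w (c k) * of_real x ^ k) sums H u" by simp
          from sums_unique2 [OF this real [OF x(2)]] show ?thesis using x(1) by simp
        qed
        show "0 islimpt (of_real ` {-1<..<1} :: complex set)"
          unfolding islimpt_approachable
        proof (intro allI impI)
          fix e :: real assume "e > 0"
          then show "\<exists>u\<in>of_real ` {-1<..<1}. u \<noteq> (0::complex) \<and> dist u 0 < e"
            \<comment> \<open>The minimum keeps the witness positive, below \<open>e\<close> and
              inside the interval.\<close>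
            by (intro bexI [of _ "of_real (min (e / 2) (1 / 2))"] imageI) (auto simp: min_def)
        qed
      qed (use z in auto)
      then have "(\<lambda>k. cpart n w (c k) * z ^ k) sums cpart n w (g y)"
        using H [OF z] by (simp add: h_def yz)
      then have "(\<lambda>k. cpart n w (act (y ^ k) (c k))) sums cpart n w (g y)"
        by (simp add: cpart_act_power [OF n] mult.commute flip: yz)
      \<comment> \<open>Real parts lead back to the coordinate along the arbitrary
        \<open>w\<close>.\<close>
      from sums_Re [OF this] show ?thesis by (simp add: Re_cpart)
    qed
    then show ?thesis
      unfolding sums_def by (subst tendsto_componentwise_iff) (simp add: inner_sum_left)
  qed
  then show ?thesis by (rule that)
qed

end

section \<open>Left and right multiplication as actions\<close>

interpretation left_mult: quat_action "\<lambda>p q. p * q"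
  by (intro quat_action.intro bounded_bilinear_mult quat_action_axioms.intro)
    (rule mult_1_left mult.assoc)+

interpretation right_mult: quat_action "\<lambda>p q. q * p"
proof (intro quat_action.intro quat_action_axioms.intro)
  show "bounded_bilinear (\<lambda>p q :: quat. q * p)"
    by (rule bounded_bilinear.flip [OF bounded_bilinear_mult])
  \<comment> \<open>Right multiplications compose in reversed order, which is harmless for commuting
    factors.\<close>
  show "q * (p * r) = q * r * p" if "p * r = r * p" for p q r :: quat
    using that by (metis mult.assoc)
qed (rule mult_1_right)

section \<open>Transport along the diffeomorphism\<close>

lemma partial_deriv_eq:
  assumes "(f has_derivative f') (at x)"
  shows "partial_deriv e f x = f' e"
proof -
  interpret f': bounded_linear f' using assms by (rule has_derivative_bounded_linear)
  have "((\<lambda>h::real. x + h *\<^sub>R e) has_derivative (\<lambda>h. h *\<^sub>R e)) (at 0)"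
    by (auto intro!: derivative_eq_intros)
  then have "((\<lambda>h::real. f (x + h *\<^sub>R e)) has_derivative (\<lambda>h. f' (h *\<^sub>R e))) (at 0)"
    by (rule has_derivative_compose) (simp add: assms)
  then show ?thesis
    unfolding partial_deriv_def
    by (intro vector_derivative_at) (simp add: has_vector_derivative_def f'.scaleR)
qed

lemma bounded_linear_qRe: "bounded_linear qRe"
  by (intro linear_conv_bounded_linear [THEN iffD1] linearI)
    (simp_all add: plus_quat_def scaleR_quat_def)

lemma bounded_linear_qVec: "bounded_linear qVec"
  by (intro linear_conv_bounded_linear [THEN iffD1] linearI)
    (simp_all add: plus_quat_def scaleR_quat_def)

lemma bounded_linear_Quat_0: "bounded_linear (Quat 0)"
  by (intro linear_conv_bounded_linear [THEN iffD1] linearI)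
    (simp_all add: plus_quat_def scaleR_quat_def)

text \<open>The lifted map splits into the identity on real parts and \<open>b\<close> on vector
  parts, so its derivative is again a lift.\<close>

lemma has_derivative_lift_map:
  assumes "(b has_derivative b') (at (qVec y))"
  shows "(lift_map b has_derivative lift_map b') (at y)"
proof -
  have *: "lift_map d = (\<lambda>x. qRe x *\<^sub>R 1 + Quat 0 (d (qVec x)))" for d
    by (rule ext) (simp add: lift_map_def plus_quat_def scaleR_quat_def one_quat_def)
  have "((\<lambda>x. b (qVec x)) has_derivative (\<lambda>x. b' (qVec x))) (at y)"
    by (rule has_derivative_compose [OF bounded_linear_imp_has_derivative
          [OF bounded_linear_qVec] assms])
  from bounded_linear.has_derivative [OF bounded_linear_Quat_0 this]
  show ?thesis
    unfolding * by (intro has_derivative_add bounded_linear_imp_has_derivative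
        bounded_linear_scaleR_const bounded_linear_qRe)
qed

text \<open>The weights \<open>a v $ j\<close> are the coordinates of \<open>a v\<close>, so
  linearity collects the weighted partial derivatives into one derivative of the inverse in the
  direction of its own argument \<open>a v\<close>.\<close>

lemma ucoeff_eq:
  assumes b: "(inv_into U a has_derivative b') (at (a v))"
  shows "ucoeff U a i v = b' (a v) $ i"
proof -
  interpret b': bounded_linear b' using b by (rule has_derivative_bounded_linear)
  have "((\<lambda>y. inv_into U a y $ i) has_derivative (\<lambda>e. b' e $ i)) (at (a v))"
    by (rule bounded_linear.has_derivative [OF bounded_linear_vec_nth b])
  then have "ucoeff U a i v = (\<Sum>j\<in>UNIV. a v $ j * b' (axis j 1) $ i)"
    by (simp add: ucoeff_def partial_deriv_eq)
  also have "\<dots> = b' (\<Sum>j\<in>UNIV. a v $ j *\<^sub>R axis j 1) $ i"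
    by (simp add: b'.sum b'.scaleR)
  also have "(\<Sum>j\<in>UNIV. a v $ j *\<^sub>R axis j 1) = a v"
    using basis_expansion [of "a v"] by (simp add: scalar_mult_eq_scaleR)
  finally show ?thesis .
qed

text \<open>This is the chain rule term that appears when \<open>f\<close> composed with the lifted
  inverse is differentiated along the vector part of its argument.\<close>

lemma sum_ucoeff_partial_deriv:
  assumes b: "(inv_into U a has_derivative b') (at (a (qVec x)))"
    and f: "(f has_derivative f') (at x)"
  shows "(\<Sum>i\<in>UNIV. ucoeff U a i (qVec x) *\<^sub>R partial_deriv (qunit i) f x)
    = f' (Quat 0 (b' (a (qVec x))))"
proof -
  interpret f': bounded_linear f' using f by (rule has_derivative_bounded_linear)
  have "(\<Sum>i\<in>UNIV. ucoeff U a i (qVec x) *\<^sub>R partial_deriv (qunit i) f x)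
      = f' (\<Sum>i\<in>UNIV. b' (a (qVec x)) $ i *\<^sub>R qunit i)"
    by (simp add: ucoeff_eq [OF b] partial_deriv_eq [OF f] f'.sum f'.scaleR)
  also have "(\<Sum>i\<in>UNIV. b' (a (qVec x)) $ i *\<^sub>R qunit i) = Quat 0 (b' (a (qVec x)))"
    using quat_expansion [of "Quat 0 (b' (a (qVec x)))"] by simp
  finally show ?thesis .
qed

text \<open>Composing with the lifted inverse turns \<open>eq\<close> into the slice Cauchy-Riemann
  equation on the unit ball; the resulting expansion is then read back at \<open>x\<close>.\<close>

lemma (in quat_action) transported_power_series:
  fixes U V :: "(real^3) set" and s t :: ereal and a :: "real^3 \<Rightarrow> real^3"
    and f :: "quat \<Rightarrow> 'b"
  assumes diffeo: "C1_diffeomorphism U V a"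
    and ball: "ball 0 1 \<subseteq> cylinder s t V"
    and f: "C1_on (cylinder s t U) f"
    and eq: "\<And>x. x \<in> cylinder s t U \<Longrightarrow>
      act (Quat 0 (a (qVec x))) (partial_deriv 1 f x)
      = (\<Sum>i\<in>UNIV. ucoeff U a i (qVec x) *\<^sub>R partial_deriv (qunit i) f x)"
  shows "\<exists>c. \<forall>x \<in> lift_map (inv_into U a) ` ball 0 1.
    (\<lambda>k. act (lift_map a x ^ k) (c k)) sums f x"
proof -
  let ?b = "inv_into U a"
  have bij: "bij_betw a U V" using diffeo by (simp add: C1_diffeomorphism_def)
  obtain b' where b': "\<And>v. v \<in> V \<Longrightarrow> (?b has_derivative blinfun_apply (b' v)) (at v)"
    using diffeo by (auto simp: C1_diffeomorphism_def C1_on_def)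
  obtain f' where f': "\<And>x. x \<in> cylinder s t U \<Longrightarrow>
      (f has_derivative blinfun_apply (f' x)) (at x)"
    using f by (auto simp: C1_on_def)
  have inv: "a (?b v) = v" "?b v \<in> U" if "v \<in> V" for v
    using bij_betw_inv_into_right [OF bij that] bij_betw_apply [OF bij_betw_inv_into [OF bij] that]
    by auto
  have cyl: "lift_map ?b y \<in> cylinder s t U" "qVec y \<in> V" if "y \<in> ball 0 1" for y
    using that ball inv by (auto simp: cylinder_def lift_map_def)
  obtain c where c: "\<And>y. y \<in> ball 0 1 \<Longrightarrow> (\<lambda>k. act (y ^ k) (c k)) sums f (lift_map ?b y)"
  proof (rule slice_power_series)
    fix y :: quat assume y: "y \<in> ball 0 1"
    let ?x = "lift_map ?b y" and ?v = "qVec y"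
    show "((\<lambda>y. f (lift_map ?b y)) has_derivative
        (\<lambda>e. f' ?x (lift_map (b' ?v) e))) (at y)"
      by (rule has_derivative_compose [OF has_derivative_lift_map [OF b' [OF cyl(2) [OF y]]]
            f' [OF cyl(1) [OF y]]])
    have av: "a (qVec ?x) = ?v" using inv(1) [OF cyl(2) [OF y]] by (simp add: lift_map_def)
    have "act (Quat 0 ?v) (f' ?x 1) = f' ?x (Quat 0 (b' ?v ?v))"
      using eq [OF cyl(1) [OF y]] b' [OF cyl(2) [OF y]]
        sum_ucoeff_partial_deriv [OF _ f' [OF cyl(1) [OF y]], of U a "b' ?v"]
      by (simp only: av partial_deriv_eq [OF f' [OF cyl(1) [OF y]]])
    \<comment> \<open>The lifted derivative fixes the direction \<open>1\<close>, so the derivative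
      along the real axis is unchanged, while the direction \<open>?v\<close> becomes the one in the
      equation for \<open>f\<close>.\<close>
    moreover have "lift_map (b' ?v) 1 = 1" "lift_map (b' ?v) (Quat 0 ?v) = Quat 0 (b' ?v ?v)"
      by (simp_all add: lift_map_def one_quat_def)
    ultimately show "act (Quat 0 ?v) (f' ?x (lift_map (b' ?v) 1))
        = f' ?x (lift_map (b' ?v) (Quat 0 ?v))"
      by (simp only:)
  qed blast
  have "lift_map a (lift_map ?b y) = y" if "y \<in> ball 0 1" for y
    using inv(1) [OF cyl(2) [OF that]] by (simp add: lift_map_def)
  with c show ?thesis by (intro exI [of _ c]) auto
qed

theorem proposition3p18:
  fixes U V :: "(real^3) set" and s t :: ereal and a :: "real^3 \<Rightarrow> real^3"
  assumes "open U" "connected U" "U \<noteq> {}"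
    and "open V" "connected V" "V \<noteq> {}"
    and "s < t"
    and "C1_diffeomorphism U V a"
    and "ball 0 1 \<subseteq> cylinder s t V"
  shows "(\<forall>f :: quat \<Rightarrow> quat.
            C1_on (cylinder s t U) f \<and> (\<forall>x\<in>cylinder s t U. H_left U a f x = 0) \<longrightarrow>
            (\<exists>c :: nat \<Rightarrow> quat. \<forall>x \<in> lift_map (inv_into U a) ` ball 0 1.
               (\<lambda>k. lift_map a x ^ k * c k) sums f x)) \<and>
         (\<forall>f :: quat \<Rightarrow> quat.
            C1_on (cylinder s t U) f \<and> (\<forall>x\<in>cylinder s t U. H_right U a f x = 0) \<longrightarrow>
            (\<exists>c :: nat \<Rightarrow> quat. \<forall>x \<in> lift_map (inv_into U a) ` ball 0 1.
               (\<lambda>k. c k * lift_map a x ^ k) sums f x))"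
proof (intro conjI allI impI; elim conjE)
  fix f :: "quat \<Rightarrow> quat"
  assume f: "C1_on (cylinder s t U) f"
  {
    assume "\<forall>x\<in>cylinder s t U. H_left U a f x = 0"
    then show "\<exists>c :: nat \<Rightarrow> quat. \<forall>x \<in> lift_map (inv_into U a) ` ball 0 1.
        (\<lambda>k. lift_map a x ^ k * c k) sums f x"
      \<comment> \<open>Moving the sum to the other side of the vanishing operator gives the
        hypothesis \<open>eq\<close> for this action.\<close>
      by (intro left_mult.transported_power_series [OF assms(8,9) f]) (simp add: H_left_def)
  next
    assume "\<forall>x\<in>cylinder s t U. H_right U a f x = 0"
    then show "\<exists>c :: nat \<Rightarrow> quat. \<forall>x \<in> lift_map (inv_into U a) ` ball 0 1.
        (\<lambda>k. c k * lift_map a x ^ k) sums f x"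
      by (intro right_mult.transported_power_series [OF assms(8,9) f]) (simp add: H_right_def)
  }
qed

end
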